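(* Let $\rho,\sigma,\tau$ be nonnegative integers with $\rho+\sigma+\tau=N$. Then $$\tilde x^\rho\tilde y^\sigma\tilde z^\tau = N!\,\nu^N\sum_{\substack{r,s,t\ge 0\\ r+s+t=N}}P(s,t,\sigma,\tau)\,\frac{\tilde\eta_0^r\tilde\eta_1^s\tilde\eta_2^t}{r!\,s!\,t!}\,\frac{x^ry^sz^t}{\vartheta^N}$$ and $$x^\rho y^\sigma z^\tau = N!\,\nu^N\sum_{\substack{r,s,t\ge 0\\ r+s+t=N}}P(\sigma,\tau,s,t)\,\frac{\eta_0^r\eta_1^s\eta_2^t}{r!\,s!\,t!}\,\frac{\tilde x^r\tilde y^s\tilde z^t}{\tilde\vartheta^N}.$$
   Context: Let $p_1,p_2,p_3,p_4\in\mathbb C$ be such that all of $p_1,\ p_2,\ p_3,\ p_4,\ p_1+p_2,\ p_1+p_3,\ p_2+p_4,\ p_3+p_4,\ p_1+p_2+p_3+p_4,\ p_1p_4-p_2p_3$ are nonzero, and let $N\ge 0$ be an integer. Put $S=p_1+p_2+p_3+p_4$ and $$\mathbf t=\tfrac{(p_1+p_2)(p_1+p_3)}{p_1S},\quad \mathbf u=\tfrac{(p_1+p_3)(p_3+p_4)}{p_3S},\quad \mathbf v=\tfrac{(p_1+p_2)(p_2+p_4)}{p_2S},\quad \mathbf w=\tfrac{(p_2+p_4)(p_3+p_4)}{p_4S}.$$ With $(\alpha)_n=\alpha(\alpha+1)\cdots(\alpha+n-1)$, define the polynomial $$P(a,b,c,d)=\sum_{\substack{i,j,k,\ell\ge 0\\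 i+j+k+\ell\le N}}\frac{(-a)_{i+j}(-b)_{k+\ell}(-c)_{i+k}(-d)_{j+\ell}}{i!\,j!\,k!\,\ell!\,(-N)_{i+j+k+\ell}}\,\mathbf t^i\mathbf u^j\mathbf v^k\mathbf w^\ell .$$ Put $$\nu=\tfrac{(p_1+p_2)(p_1+p_3)(p_2+p_4)(p_3+p_4)}{(p_1p_4-p_2p_3)^2},\qquad \eta_0=\tilde\eta_0=\nu^{-1},$$ $$\eta_1=\tfrac{p_1p_2S}{(p_1+p_2)(p_1+p_3)(p_2+p_4)},\quad \eta_2=\tfrac{p_3p_4S}{(p_1+p_3)(p_2+p_4)(p_3+p_4)},\quad \tilde\eta_1=\tfrac{p_1p_3S}{(p_1+p_2)(p_1+p_3)(p_3+p_4)},\quad \tilde\eta_2=\tfrac{p_2p_4S}{(p_1+p_2)(p_2+p_4)(p_3+p_4)},$$ $$\vartheta=\tfrac{(p_1+p_3)(p_2+p_4)}{p_2p_3-p_1p_4},\qquad \tilde\vartheta=\tfrac{(p_1+p_2)(p_3+p_4)}{p_2p_3-p_1p_4}.$$ Let $x,y,z$ be commuting indeterminates, and in $\mathbb C[x,y,z]$ define $$\tilde x=\tilde\vartheta(\tilde\eta_0x+\tilde\eta_1y+\tilde\eta_2z),\quad \tilde y=\tilde\vartheta\big(\tilde\eta_0x+(1-\mathbf t)\tilde\eta_1y+(1-\mathbf v)\tilde\eta_2z\big),\quad \tilde z=\tilde\vartheta\big(\tilde\eta_0x+(1-\mathbf u)\tilde\eta_1y+(1-\mathbf w)\tilde\eta_2z\big).$$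 *)

theory Defs
  imports Complex_Main "HOL-Library.Poly_Mapping"
begin

text \<open>
  The rational functions of \<open>p\<^sub>1, \<dots>, p\<^sub>4\<close>. They are total functions here (division by zero
  yields zero); the nonvanishing assumptions on the \<open>p\<^sub>i\<close> make every denominator nonzero.
\<close>

definition bft :: "complex \<Rightarrow> complex \<Rightarrow> complex \<Rightarrow> complex \<Rightarrow> complex" where
  "bft p1 p2 p3 p4 = (p1 + p2) * (p1 + p3) / (p1 * (p1 + p2 + p3 + p4))"

definition bfu :: "complex \<Rightarrow> complex \<Rightarrow> complex \<Rightarrow> complex \<Rightarrow> complex" where
  "bfu p1 p2 p3 p4 = (p1 + p3) * (p3 + p4) / (p3 * (p1 + p2 + p3 + p4))"

definition bfv :: "complex \<Rightarrow> complex \<Rightarrow> complex \<Rightarrow> complex \<Rightarrow> complex" where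
  "bfv p1 p2 p3 p4 = (p1 + p2) * (p2 + p4) / (p2 * (p1 + p2 + p3 + p4))"

definition bfw :: "complex \<Rightarrow> complex \<Rightarrow> complex \<Rightarrow> complex \<Rightarrow> complex" where
  "bfw p1 p2 p3 p4 = (p2 + p4) * (p3 + p4) / (p4 * (p1 + p2 + p3 + p4))"

definition polyP :: "nat \<Rightarrow> complex \<Rightarrow> complex \<Rightarrow> complex \<Rightarrow> complex \<Rightarrow>
    complex \<Rightarrow> complex \<Rightarrow> complex \<Rightarrow> complex \<Rightarrow> complex" where
  "polyP N p1 p2 p3 p4 a b c d =
     (\<Sum>(i, j, k, l) \<in> {(i, j, k, l). i + j + k + l \<le> N}.
        (pochhammer (- a) (i + j) * pochhammer (- b) (k + l) *
         pochhammer (- c) (i + k) * pochhammer (- d) (j + l)) /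
        (fact i * fact j * fact k * fact l * pochhammer (- of_nat N) (i + j + k + l)) *
        bft p1 p2 p3 p4 ^ i * bfu p1 p2 p3 p4 ^ j * bfv p1 p2 p3 p4 ^ k * bfw p1 p2 p3 p4 ^ l)"

definition nu :: "complex \<Rightarrow> complex \<Rightarrow> complex \<Rightarrow> complex \<Rightarrow> complex" where
  "nu p1 p2 p3 p4 =
     (p1 + p2) * (p1 + p3) * (p2 + p4) * (p3 + p4) / (p1 * p4 - p2 * p3)\<^sup>2"

definition eta0 :: "complex \<Rightarrow> complex \<Rightarrow> complex \<Rightarrow> complex \<Rightarrow> complex" where
  "eta0 p1 p2 p3 p4 = inverse (nu p1 p2 p3 p4)"

definition eta1 :: "complex \<Rightarrow> complex \<Rightarrow> complex \<Rightarrow> complex \<Rightarrow> complex" where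
  "eta1 p1 p2 p3 p4 = p1 * p2 * (p1 + p2 + p3 + p4) / ((p1 + p2) * (p1 + p3) * (p2 + p4))"

definition eta2 :: "complex \<Rightarrow> complex \<Rightarrow> complex \<Rightarrow> complex \<Rightarrow> complex" where
  "eta2 p1 p2 p3 p4 = p3 * p4 * (p1 + p2 + p3 + p4) / ((p1 + p3) * (p2 + p4) * (p3 + p4))"

definition eta0_tilde :: "complex \<Rightarrow> complex \<Rightarrow> complex \<Rightarrow> complex \<Rightarrow> complex" where
  "eta0_tilde p1 p2 p3 p4 = inverse (nu p1 p2 p3 p4)"

definition eta1_tilde :: "complex \<Rightarrow> complex \<Rightarrow> complex \<Rightarrow> complex \<Rightarrow> complex" where
  "eta1_tilde p1 p2 p3 p4 = p1 * p3 * (p1 + p2 + p3 + p4) / ((p1 + p2) * (p1 + p3) * (p3 + p4))"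

definition eta2_tilde :: "complex \<Rightarrow> complex \<Rightarrow> complex \<Rightarrow> complex \<Rightarrow> complex" where
  "eta2_tilde p1 p2 p3 p4 = p2 * p4 * (p1 + p2 + p3 + p4) / ((p1 + p2) * (p2 + p4) * (p3 + p4))"

definition theta :: "complex \<Rightarrow> complex \<Rightarrow> complex \<Rightarrow> complex \<Rightarrow> complex" where
  "theta p1 p2 p3 p4 = (p1 + p3) * (p2 + p4) / (p2 * p3 - p1 * p4)"

definition theta_tilde :: "complex \<Rightarrow> complex \<Rightarrow> complex \<Rightarrow> complex \<Rightarrow> complex" where
  "theta_tilde p1 p2 p3 p4 = (p1 + p2) * (p3 + p4) / (p2 * p3 - p1 * p4)"

text \<open>
  The ring \<open>\<complex>[x, y, z]\<close> as the monoid algebra over \<open>\<complex>\<close> of the free commutative monoid on three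
  generators: a monomial is its exponent vector, and the ring structure (with convolution as
  multiplication) is the one of \<^theory>\<open>HOL-Library.Poly_Mapping\<close>.
\<close>

datatype indet = Ix | Iy | Iz

type_synonym cpoly3 = "(indet \<Rightarrow>\<^sub>0 nat) \<Rightarrow>\<^sub>0 complex"

definition const :: "complex \<Rightarrow> cpoly3" where
  "const c = Poly_Mapping.single 0 c"

definition var :: "indet \<Rightarrow> cpoly3" where
  "var i = Poly_Mapping.single (Poly_Mapping.single i 1) 1"

definition x_tilde :: "complex \<Rightarrow> complex \<Rightarrow> complex \<Rightarrow> complex \<Rightarrow> cpoly3" where
  "x_tilde p1 p2 p3 p4 = const (theta_tilde p1 p2 p3 p4) *
     (const (eta0_tilde p1 p2 p3 p4) * var Ix +
      const (eta1_tilde p1 p2 p3 p4) * var Iy +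
      const (eta2_tilde p1 p2 p3 p4) * var Iz)"

definition y_tilde :: "complex \<Rightarrow> complex \<Rightarrow> complex \<Rightarrow> complex \<Rightarrow> cpoly3" where
  "y_tilde p1 p2 p3 p4 = const (theta_tilde p1 p2 p3 p4) *
     (const (eta0_tilde p1 p2 p3 p4) * var Ix +
      const ((1 - bft p1 p2 p3 p4) * eta1_tilde p1 p2 p3 p4) * var Iy +
      const ((1 - bfv p1 p2 p3 p4) * eta2_tilde p1 p2 p3 p4) * var Iz)"

definition z_tilde :: "complex \<Rightarrow> complex \<Rightarrow> complex \<Rightarrow> complex \<Rightarrow> cpoly3" where
  "z_tilde p1 p2 p3 p4 = const (theta_tilde p1 p2 p3 p4) *
     (const (eta0_tilde p1 p2 p3 p4) * var Ix +
      const ((1 - bfu p1 p2 p3 p4) * eta1_tilde p1 p2 p3 p4) * var Iy +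
      const ((1 - bfw p1 p2 p3 p4) * eta2_tilde p1 p2 p3 p4) * var Iz)"

end

theory Submission
  imports Defs
begin

text \<open>
  With \<open>X = \<eta>\<^sub>0 x\<close>, \<open>Y = \<eta>\<^sub>1 y\<close>, \<open>Z = \<eta>\<^sub>2 z\<close> (tildes on the \<open>\<eta>\<close>) and \<open>G = X + Y + Z\<close>, the
  three tilde variables are, up to a common factor, \<open>G\<close>, \<open>G - t Y - v Z\<close> and \<open>G - u Y - w Z\<close>.
  Expanding the powers of the last two around \<open>G\<close> produces the summation indices \<open>i, k\<close> and
  \<open>j, l\<close> of \<open>P\<close>, and expanding the remaining power of \<open>G\<close> produces the monomials in \<open>x, y, z\<close>.
  The second identity is the first one with \<open>p\<^sub>2\<close> and \<open>p\<^sub>3\<close> exchanged, evaluated at the tilde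
  variables: the exchanged substitution inverts the original one.
\<close>

section \<open>Constants in the polynomial ring\<close>

lemma const_0 [simp]: "const 0 = 0"
  by (simp add: const_def)

lemma const_1 [simp]: "const 1 = 1"
  by (simp add: const_def)

lemma const_add: "const (a + b) = const a + const b"
  by (simp add: const_def single_add)

lemma const_mult: "const (a * b) = const a * const b"
  by (simp add: const_def mult_single)

lemma const_diff: "const (a - b) = const a - const b"
  by (simp add: const_def single_diff)

lemma const_minus: "const (- a) = - const a"
  by (simp add: const_def single_uminus)

lemma const_power: "const (a ^ n) = const a ^ n"
  by (induction n) (simp_all add: const_mult)

lemma const_sum: "const (sum f A) = (\<Sum>x\<in>A. const (f x))"
  by (induction A rule: infinite_finite_induct) (simp_all add: const_add)

lemma const_of_nat: "const (of_nat n) = of_nat n"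
  by (induction n) (simp_all add: const_add)

section \<open>Trinomial expansion\<close>

lemma finite_triples [simp]: "finite {(a, b, c). a + b + c = (n::nat)}"
  by (rule finite_subset[of _ "{..n} \<times> {..n} \<times> {..n}"]) auto

lemma finite_quadruples [simp]: "finite {(i, j, k, l). i + j + k + l \<le> (n::nat)}"
  by (rule finite_subset[of _ "{..n} \<times> {..n} \<times> {..n} \<times> {..n}"]) auto

text \<open>The binomial theorem is applied twice, and the product of the two binomial coefficients
  is the trinomial coefficient. It is written as a complex quotient of factorials under
  \<open>const\<close> so that it can be merged with the coefficients of
  \<open>hyperP\<close>.\<close>

lemma trinomial:
  fixes A B C :: cpoly3
  shows "(A + B + C) ^ n =
    (\<Sum>(a, b, c) \<in> {(a, b, c). a + b + c = n}.
       const (fact n / (fact a * fact b * fact c)) * (A ^ a * B ^ b * C ^ c))"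
proof -
  \<comment> \<open>With \<open>B + C\<close> in front, the outer binomial index \<open>m\<close> is
    the exponent of \<open>B + C\<close>.\<close>
  have "(A + B + C) ^ n = ((B + C) + A) ^ n"
    by (simp add: add_ac)
  also have "\<dots> = (\<Sum>m\<le>n. \<Sum>b\<le>m. of_nat (n choose m) * of_nat (m choose b) *
      (A ^ (n - m) * B ^ b * C ^ (m - b)))"
    by (simp add: binomial_ring sum_distrib_left sum_distrib_right mult_ac)
  also have "\<dots> = (\<Sum>(m, b) \<in> Sigma {..n} (\<lambda>m. {..m}). of_nat (n choose m) * of_nat (m choose b) *
      (A ^ (n - m) * B ^ b * C ^ (m - b)))"
    by (subst sum.Sigma) auto
  also have "\<dots> = (\<Sum>(a, b, c) \<in> {(a, b, c). a + b + c = n}.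
       const (fact n / (fact a * fact b * fact c)) * (A ^ a * B ^ b * C ^ c))"
  proof (rule sum.reindex_bij_witness[where i = "\<lambda>(a, b, c). (b + c, b)"
        and j = "\<lambda>(m, b). (n - m, b, m - b)"], goal_cases)
    case (5 x)
    then obtain m b where x: "x = (m, b)" and le: "b \<le> m" "m \<le> n"
      by auto
    have "of_nat (n choose m) * of_nat (m choose b) =
        (fact n / (fact (n - m) * fact b * fact (m - b)) :: complex)"
      using le by (simp add: binomial_fact)
    then have "const (fact n / (fact (n - m) * fact b * fact (m - b))) =
        of_nat (n choose m) * of_nat (m choose b)"
      by (metis const_mult const_of_nat)
    then show ?case
      by (simp add: x)
  qed auto
  finally show ?thesis .
qed

section \<open>The hypergeometric sum with free parameters\<close>

text \<open>Freeing \<open>t\<close>, \<open>u\<close>, \<open>v\<close>, \<open>w\<close> from the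
  \<open>p\<close>'s separates the expansion, which holds for all values of them, from the relations
  among the actual parameters, which matter only for inverting the substitution.\<close>

definition hyperP :: "nat \<Rightarrow> complex \<Rightarrow> complex \<Rightarrow> complex \<Rightarrow> complex \<Rightarrow>
    complex \<Rightarrow> complex \<Rightarrow> complex \<Rightarrow> complex \<Rightarrow> complex" where
  "hyperP N t u v w a b c d =
     (\<Sum>(i, j, k, l) \<in> {(i, j, k, l). i + j + k + l \<le> N}.
        (pochhammer (- a) (i + j) * pochhammer (- b) (k + l) *
         pochhammer (- c) (i + k) * pochhammer (- d) (j + l)) /
        (fact i * fact j * fact k * fact l * pochhammer (- of_nat N) (i + j + k + l)) *
        t ^ i * u ^ j * v ^ k * w ^ l)"

text \<open>Renaming the summation indices \<open>j\<close> and \<open>k\<close> into each other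
  exchanges the first and second pairs of Pochhammer symbols.\<close>

lemma hyperP_swap: "hyperP N t u v w a b c d = hyperP N t v u w c d a b"
  unfolding hyperP_def
  by (rule sum.reindex_bij_witness[where i = "\<lambda>(i, j, k, l). (i, k, j, l)"
        and j = "\<lambda>(i, j, k, l). (i, k, j, l)"]) (auto simp: ac_simps)

text \<open>Up to sign this is a falling factorial, read off from the generalized binomial
  coefficient. Writing the parameter as \<open>a + b\<close> avoids truncated subtraction.\<close>

lemma pochhammer_minus_of_nat:
  "pochhammer (- of_nat (a + b) :: complex) a = (- 1) ^ a * fact (a + b) / fact b"
proof -
  have "fact (a + b) / (fact a * fact b) = (of_nat (a + b) gchoose a :: complex)"
    using binomial_fact[of a "a + b", where ?'a = complex] by (simp add: binomial_gbinomial)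
  also have "\<dots> = (- 1) ^ a * pochhammer (- of_nat (a + b)) a / fact a"
    by (rule gbinomial_pochhammer)
  finally have "fact (a + b) / fact b = (- 1) ^ a * pochhammer (- of_nat (a + b) :: complex) a"
    by (simp add: field_simps)
  then have "(- 1) ^ a * (fact (a + b) / fact b) =
      (- 1) ^ a * ((- 1) ^ a * pochhammer (- of_nat (a + b) :: complex) a)"
    by simp
  then show ?thesis
    by (simp add: mult.assoc[symmetric] power_mult_distrib[symmetric])
qed

text \<open>The field identity behind \<open>hyperP_summand\<close>. There \<open>a\<close>,
  \<open>b\<close>, \<open>c\<close>, \<open>d\<close> are the signs \<open>(-1)^i\<close>,
  \<open>(-1)^j\<close>, \<open>(-1)^k\<close>, \<open>(-1)^l\<close>, and names containing
  \<open>f\<close> stand for factorials, \<open>jf\<close> for the product of four. Each sign occurs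
  twice in the numerator and once in the denominator, so one copy is left for each of the powers
  \<open>T\<close>, \<open>U\<close>, \<open>V\<close>, \<open>W\<close>.\<close>

lemma cancel_quotient_factors:
  fixes Nf :: complex
  assumes nz: "Nf \<noteq> 0" "sf \<noteq> 0" "qf \<noteq> 0" "a \<noteq> 0" "b \<noteq> 0" "c \<noteq> 0" "d \<noteq> 0"
  shows "Nf / (rf * sf * qf) *
      (((a * b * sf / sf') * (c * d * qf / qf') * (a * c * xf / ef) * (b * d * yf / ff)) /
       (jf * (a * b * c * d * Nf / nf)) * T * U * V * W) =
      xf * yf * nf / (jf * ef * ff * (rf * sf' * qf')) * ((a * T) * (b * U) * (c * V) * (d * W))"
proof -
  define P where "P = xf * yf * nf * T * U * V * W"
  define Q where "Q = jf * ef * ff * rf * sf' * qf'"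
  define Z where "Z = Nf * sf * qf * a * b * c * d"
  have "Nf / (rf * sf * qf) *
      (((a * b * sf / sf') * (c * d * qf / qf') * (a * c * xf / ef) * (b * d * yf / ff)) /
       (jf * (a * b * c * d * Nf / nf)) * T * U * V * W) = (Z * (P * (a * b * c * d))) / (Z * Q)"
    unfolding P_def Q_def Z_def
    by (simp only: times_divide_times_eq divide_divide_eq_left divide_divide_eq_right
        times_divide_eq_left times_divide_eq_right mult_ac)
  also have "\<dots> = P * (a * b * c * d) / Q"
    using nz by (intro nonzero_mult_divide_mult_cancel_left) (simp add: Z_def)
  also have "\<dots> = xf * yf * nf / (jf * ef * ff * (rf * sf' * qf')) * ((a * T) * (b * U) * (c * V) * (d * W))"
    unfolding P_def Q_def by (simp only: times_divide_eq_left times_divide_eq_right mult_ac)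
  finally show ?thesis .
qed

text \<open>Every Pochhammer symbol becomes a signed quotient of factorials, and these regroup into
  the coefficients of three trinomial expansions: of the \<sigma>-th power, of the \<tau>-th power,
  and of the power of \<open>X + Y + Z\<close> with exponent \<open>n\<close>.\<close>

lemma hyperP_summand:
  assumes "s = s' + (i + j)" "q = q' + (k + l)" "\<sigma> = e + (i + k)" "\<tau> = f + (j + l)"
    and "N = n + (i + j + k + l)"
  shows "fact N / (fact r * fact s * fact q) *
      ((pochhammer (- of_nat s) (i + j) * pochhammer (- of_nat q) (k + l) *
        pochhammer (- of_nat \<sigma>) (i + k) * pochhammer (- of_nat \<tau>) (j + l)) /
       (fact i * fact j * fact k * fact l * pochhammer (- of_nat N) (i + j + k + l)) *
       t ^ i * u ^ j * v ^ k * w ^ l) =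
     fact \<sigma> / (fact i * fact k * fact e) * (fact \<tau> / (fact j * fact l * fact f)) *
     (fact n / (fact r * fact s' * fact q')) *
     ((- t) ^ i * (- u) ^ j * (- v) ^ k * (- w :: complex) ^ l)"
proof -
  note P = pochhammer_minus_of_nat
  have 1: "pochhammer (- of_nat s) (i + j) = (- 1) ^ (i + j) * fact s / (fact s' :: complex)"
    using P[of "i + j" s'] assms(1) by (simp only: add.commute)
  have 2: "pochhammer (- of_nat q) (k + l) = (- 1) ^ (k + l) * fact q / (fact q' :: complex)"
    using P[of "k + l" q'] assms(2) by (simp only: add.commute)
  have 3: "pochhammer (- of_nat \<sigma>) (i + k) = (- 1) ^ (i + k) * fact \<sigma> / (fact e :: complex)"
    using P[of "i + k" e] assms(3) by (simp only: add.commute)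
  have 4: "pochhammer (- of_nat \<tau>) (j + l) = (- 1) ^ (j + l) * fact \<tau> / (fact f :: complex)"
    using P[of "j + l" f] assms(4) by (simp only: add.commute)
  have 5: "pochhammer (- of_nat N) (i + j + k + l) =
      (- 1) ^ (i + j + k + l) * fact N / (fact n :: complex)"
    using P[of "i + j + k + l" n] assms(5) by (simp only: add.commute)
  show ?thesis
    unfolding 1 2 3 4 5 power_minus[of t] power_minus[of u] power_minus[of v] power_minus[of w]
      power_add
    by (subst cancel_quotient_factors, simp_all only: times_divide_times_eq times_divide_eq_left
        times_divide_eq_right mult_ac, simp_all)
qed

text \<open>Both sides are the same multiple sum: the left one is indexed by the choices made in
  three successive trinomial expansions, the right one by the resulting monomial first.\<close>

lemma hyperP_expansion:
  fixes X Y Z :: cpoly3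
  assumes N: "\<rho> + \<sigma> + \<tau> = N"
  shows "(X + Y + Z) ^ \<rho> * (X + const (1 - t) * Y + const (1 - v) * Z) ^ \<sigma> *
      (X + const (1 - u) * Y + const (1 - w) * Z) ^ \<tau> =
    (\<Sum>(r, s, q) \<in> {(r, s, q). r + s + q = N}.
       const (fact N / (fact r * fact s * fact q) *
         hyperP N t u v w (of_nat s) (of_nat q) (of_nat \<sigma>) (of_nat \<tau>)) *
       (X ^ r * Y ^ s * Z ^ q))"
proof -
  define G where "G = X + Y + Z"
  define T where "T n = {(a, b, c). a + b + c = (n::nat)}" for n
  define Q where "Q = {(i, j, k, l). i + j + k + l \<le> N}"
  define tri where "tri a b c = (fact (a + b + c) / (fact a * fact b * fact c) :: complex)" for a b c
  \<comment> \<open>The summand after all expansions: \<open>e\<close> and \<open>f\<close> are the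
    powers of \<open>G\<close> contributed by the second and third factor, and \<open>r\<close>,
    \<open>s\<close>, \<open>q\<close> come from expanding the collected power of
    \<open>G\<close>.\<close>
  define term1 where "term1 = (\<lambda>(((i, k, e), (j, l, f)), (r, s, q)).
      const (tri i k e * tri j l f * tri r s q *
        ((- t) ^ i * (- u) ^ j * (- v) ^ k * (- w) ^ l)) *
      (X ^ r * Y ^ (s + (i + j)) * Z ^ (q + (k + l))))"
  \<comment> \<open>Here \<open>s\<close> and \<open>q\<close> are the total exponents of
    \<open>Y\<close> and \<open>Z\<close>, no longer only the share coming from
    \<open>G\<close>.\<close>
  define term2 where "term2 = (\<lambda>((r, s, q), (i, j, k, l)).
      const (fact N / (fact r * fact s * fact q) *
       ((pochhammer (- of_nat s) (i + j) * pochhammer (- of_nat q) (k + l) *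
         pochhammer (- of_nat \<sigma>) (i + k) * pochhammer (- of_nat \<tau>) (j + l)) /
        (fact i * fact j * fact k * fact l * pochhammer (- of_nat N) (i + j + k + l)) *
        t ^ i * u ^ j * v ^ k * w ^ l)) * (X ^ r * Y ^ s * Z ^ q))"
  define D where "D = Sigma (T \<sigma> \<times> T \<tau>) (\<lambda>((i, k, e), (j, l, f)). T (\<rho> + e + f))"
  \<comment> \<open>The image of \<open>D\<close> under the change of indices. Its inequalities make
    the subtractions in the inverse map exact, and they fail exactly where one of the numerator
    Pochhammer symbols vanishes.\<close>
  define E where "E = {((r, s, q), (i, j, k, l)). (r, s, q) \<in> T N \<and>
      i + j \<le> s \<and> k + l \<le> q \<and> i + k \<le> \<sigma> \<and> j + l \<le> \<tau>}"
  have fin: "finite (T n)" for n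
    by (simp add: T_def)
  have tri: "(A + B + C) ^ n = (\<Sum>(a, b, c) \<in> T n. const (tri a b c) * (A ^ a * B ^ b * C ^ c))"
    for A B C :: cpoly3 and n
    unfolding trinomial T_def by (rule sum.cong) (auto simp: tri_def)
  have "(X + const (1 - t) * Y + const (1 - v) * Z) = const (- t) * Y + const (- v) * Z + G"
    by (simp add: G_def const_diff const_minus algebra_simps)
  moreover have "(X + const (1 - u) * Y + const (1 - w) * Z) = const (- u) * Y + const (- w) * Z + G"
    by (simp add: G_def const_diff const_minus algebra_simps)
  ultimately have "(X + Y + Z) ^ \<rho> * (X + const (1 - t) * Y + const (1 - v) * Z) ^ \<sigma> *
      (X + const (1 - u) * Y + const (1 - w) * Z) ^ \<tau> =
      (const (- t) * Y + const (- v) * Z + G) ^ \<sigma> *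
      (const (- u) * Y + const (- w) * Z + G) ^ \<tau> * G ^ \<rho>"
    by (simp only: G_def[symmetric] mult_ac)
  also have "\<dots> = (\<Sum>x\<in>T \<sigma>. \<Sum>y\<in>T \<tau>. case (x, y) of ((i, k, e), (j, l, f)) \<Rightarrow>
      const (tri i k e) * ((const (- t) * Y) ^ i * (const (- v) * Z) ^ k * G ^ e) *
      (const (tri j l f) * ((const (- u) * Y) ^ j * (const (- w) * Z) ^ l * G ^ f)) * G ^ \<rho>)"
    unfolding tri
    by (subst sum.swap) (simp add: case_prod_unfold sum_product sum_distrib_left
        sum_distrib_right mult.assoc)
  also have "\<dots> = (\<Sum>x\<in>T \<sigma>. \<Sum>y\<in>T \<tau>.
      \<Sum>z\<in>(case (x, y) of ((i, k, e), (j, l, f)) \<Rightarrow> T (\<rho> + e + f)). term1 ((x, y), z))"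
  proof (intro sum.cong refl, simp only: split_paired_all prod.case)
    fix i k e j l f
    have "const (tri i k e) * ((const (- t) * Y) ^ i * (const (- v) * Z) ^ k * G ^ e) *
      (const (tri j l f) * ((const (- u) * Y) ^ j * (const (- w) * Z) ^ l * G ^ f)) * G ^ \<rho> =
      const (tri i k e * tri j l f * ((- t) ^ i * (- u) ^ j * (- v) ^ k * (- w) ^ l)) *
      (Y ^ (i + j) * Z ^ (k + l)) * G ^ (\<rho> + e + f)"
      by (simp add: const_mult const_power power_mult_distrib power_add mult_ac)
    also have "\<dots> = (\<Sum>z\<in>T (\<rho> + e + f). term1 (((i, k, e), (j, l, f)), z))"
      unfolding G_def tri[of X Y Z] sum_distrib_left
      by (rule sum.cong) (auto simp: term1_def const_mult power_add mult_ac)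
    finally show "const (tri i k e) * ((const (- t) * Y) ^ i * (const (- v) * Z) ^ k * G ^ e) *
      (const (tri j l f) * ((const (- u) * Y) ^ j * (const (- w) * Z) ^ l * G ^ f)) * G ^ \<rho> =
      (\<Sum>z\<in>T (\<rho> + e + f). term1 (((i, k, e), (j, l, f)), z))" .
  qed
  also have "\<dots> = (\<Sum>p\<in>T \<sigma> \<times> T \<tau>.
      \<Sum>z\<in>(case p of ((i, k, e), (j, l, f)) \<Rightarrow> T (\<rho> + e + f)). term1 (p, z))"
    by (subst sum.cartesian_product) (rule sum.cong[OF refl], simp only: split_paired_all prod.case)
  also have "\<dots> = sum term1 D"
    unfolding D_def by (subst sum.Sigma) (simp_all add: fin case_prod_unfold)
  also have "\<dots> = sum term2 E"
  proof (rule sum.reindex_bij_witness[where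
        j = "\<lambda>(((i, k, e), (j, l, f)), (r, s, q)). ((r, s + (i + j), q + (k + l)), (i, j, k, l))" and
        i = "\<lambda>((r, s, q), (i, j, k, l)). (((i, k, \<sigma> - (i + k)), (j, l, \<tau> - (j + l))),
               (r, s - (i + j), q - (k + l)))"], goal_cases)
    case (5 x)
    then obtain i k e j l f r s q where x: "x = (((i, k, e), (j, l, f)), (r, s, q))"
      and eqs: "i + k + e = \<sigma>" "j + l + f = \<tau>" "r + s + q = \<rho> + e + f"
      by (auto simp: D_def T_def)
    \<comment> \<open>The exponent \<open>r + s + q\<close> of \<open>G\<close> takes the role of
      \<open>n\<close> in \<open>hyperP_summand\<close>.\<close>
    have "N = (r + s + q) + (i + j + k + l)" "\<sigma> = e + (i + k)" "\<tau> = f + (j + l)"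
      using eqs N by auto
    from hyperP_summand[OF refl refl this(2,3,1)] eqs show ?case
      by (simp add: x term1_def term2_def tri_def)
  qed (use N in \<open>auto simp: D_def E_def T_def\<close>)
  \<comment> \<open>Since \<open>(-m)_n = 0\<close> for natural numbers \<open>m < n\<close>, the
    sum extends by zero to the full index range of \<open>hyperP\<close>.\<close>
  also have "\<dots> = sum term2 (T N \<times> Q)"
  proof (rule sum.mono_neutral_left)
    show "finite (T N \<times> Q)"
      by (simp add: T_def Q_def)
    show "E \<subseteq> T N \<times> Q"
      using N by (auto simp: E_def T_def Q_def)
    show "\<forall>x\<in>T N \<times> Q - E. term2 x = 0"
    proof
      fix x assume "x \<in> T N \<times> Q - E"
      moreover obtain r s q i j k l where x: "x = ((r, s, q), (i, j, k, l))"
        by (metis surj_pair)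
      ultimately have "s < i + j \<or> q < k + l \<or> \<sigma> < i + k \<or> \<tau> < j + l"
        by (auto simp: E_def)
      then have "pochhammer (- of_nat s) (i + j) = (0 :: complex) \<or>
          pochhammer (- of_nat q) (k + l) = (0 :: complex) \<or>
          pochhammer (- of_nat \<sigma>) (i + k) = (0 :: complex) \<or>
          pochhammer (- of_nat \<tau>) (j + l) = (0 :: complex)"
        by (simp only: pochhammer_of_nat_eq_0_iff)
      then show "term2 x = 0"
        by (elim disjE) (simp_all add: x term2_def)
    qed
  qed
  also have "\<dots> = (\<Sum>x\<in>T N. \<Sum>y\<in>Q. term2 (x, y))"
    by (simp add: sum.cartesian_product)
  also have "\<dots> = (\<Sum>(r, s, q) \<in> T N.
       const (fact N / (fact r * fact s * fact q) *
         hyperP N t u v w (of_nat s) (of_nat q) (of_nat \<sigma>) (of_nat \<tau>)) *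
       (X ^ r * Y ^ s * Z ^ q))"
  proof (rule sum.cong[OF refl], simp only: split_paired_all prod.case)
    fix r s q
    show "(\<Sum>y\<in>Q. term2 ((r, s, q), y)) = const (fact N / (fact r * fact s * fact q) *
        hyperP N t u v w (of_nat s) (of_nat q) (of_nat \<sigma>) (of_nat \<tau>)) * (X ^ r * Y ^ s * Z ^ q)"
      unfolding hyperP_def Q_def sum_distrib_left const_sum sum_distrib_right
      by (rule sum.cong) (auto simp: term2_def mult_ac)
  qed
  finally show ?thesis
    by (simp add: T_def)
qed

section \<open>The two substitutions\<close>

lemma polyP_hyperP: "polyP N p1 p2 p3 p4 =
    hyperP N (bft p1 p2 p3 p4) (bfu p1 p2 p3 p4) (bfv p1 p2 p3 p4) (bfw p1 p2 p3 p4)"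
  by (intro ext) (simp only: polyP_def hyperP_def)

text \<open>As rewrite rules these equations loop unless they are instantiated.\<close>

lemma exchange_p2_p3:
  "bft p1 p3 p2 p4 = bft p1 p2 p3 p4"
  "bfu p1 p3 p2 p4 = bfv p1 p2 p3 p4"
  "bfv p1 p3 p2 p4 = bfu p1 p2 p3 p4"
  "bfw p1 p3 p2 p4 = bfw p1 p2 p3 p4"
  "nu p1 p3 p2 p4 = nu p1 p2 p3 p4"
  "eta0_tilde p1 p3 p2 p4 = eta0 p1 p2 p3 p4"
  "eta1_tilde p1 p3 p2 p4 = eta1 p1 p2 p3 p4"
  "eta2_tilde p1 p3 p2 p4 = eta2 p1 p2 p3 p4"
  "theta p1 p3 p2 p4 = theta_tilde p1 p2 p3 p4"
  "theta_tilde p1 p3 p2 p4 = theta p1 p2 p3 p4"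
  unfolding bft_def bfu_def bfv_def bfw_def nu_def eta0_def eta0_tilde_def eta1_def eta1_tilde_def
    eta2_def eta2_tilde_def theta_def theta_tilde_def
  by (simp_all add: ac_simps)

text \<open>The exchange of \<open>p2\<close> and \<open>p3\<close> swaps only \<open>bfu\<close>
  and \<open>bfv\<close> among the four arguments, which \<open>hyperP_swap\<close> turns into a
  swap of the parameter pairs.\<close>

lemma polyP_exchange: "polyP N p1 p3 p2 p4 a b c d = polyP N p1 p2 p3 p4 c d a b"
  unfolding polyP_hyperP exchange_p2_p3[of p1 p3 p2 p4]
  by (rule hyperP_swap)

text \<open>One linear form for all three tilde variables, chosen by \<open>g\<close> and
  \<open>h\<close>. Its arguments are arbitrary polynomials, so the tilde variables themselves can
  be inserted.\<close>

definition tilde_form :: "complex \<Rightarrow> complex \<Rightarrow> complex \<Rightarrow> complex \<Rightarrow>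
    complex \<Rightarrow> complex \<Rightarrow> cpoly3 \<Rightarrow> cpoly3 \<Rightarrow> cpoly3 \<Rightarrow> cpoly3" where
  "tilde_form p1 p2 p3 p4 g h x y z = const (theta_tilde p1 p2 p3 p4) *
     (const (eta0_tilde p1 p2 p3 p4) * x +
      const (g * eta1_tilde p1 p2 p3 p4) * y + const (h * eta2_tilde p1 p2 p3 p4) * z)"

text \<open>The first identity at arbitrary polynomials, so that it serves twice: at the
  indeterminates, and with \<open>p2\<close> and \<open>p3\<close> exchanged at the tilde
  variables.\<close>

lemma tilde_form_expansion:
  assumes nz: "p1 * p4 - p2 * p3 \<noteq> 0" "p1 + p3 \<noteq> 0" "p2 + p4 \<noteq> 0"
    and N: "\<rho> + \<sigma> + \<tau> = N"
  shows "tilde_form p1 p2 p3 p4 1 1 x y z ^ \<rho> *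
      tilde_form p1 p2 p3 p4 (1 - bft p1 p2 p3 p4) (1 - bfv p1 p2 p3 p4) x y z ^ \<sigma> *
      tilde_form p1 p2 p3 p4 (1 - bfu p1 p2 p3 p4) (1 - bfw p1 p2 p3 p4) x y z ^ \<tau> =
    const (fact N * nu p1 p2 p3 p4 ^ N) *
       (\<Sum>(r, s, t) \<in> {(r, s, t). r + s + t = N}.
          const (polyP N p1 p2 p3 p4 (of_nat s) (of_nat t) (of_nat \<sigma>) (of_nat \<tau>) *
                 (eta0_tilde p1 p2 p3 p4 ^ r * eta1_tilde p1 p2 p3 p4 ^ s * eta2_tilde p1 p2 p3 p4 ^ t /
                  (fact r * fact s * fact t)) / theta p1 p2 p3 p4 ^ N) *
          (x ^ r * y ^ s * z ^ t))"
    (is "?L = ?R")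
proof -
  define th where "th = theta_tilde p1 p2 p3 p4"
  define X where "X = const (eta0_tilde p1 p2 p3 p4) * x"
  define Y where "Y = const (eta1_tilde p1 p2 p3 p4) * y"
  define Z where "Z = const (eta2_tilde p1 p2 p3 p4) * z"
  have "p2 * p3 - p1 * p4 \<noteq> 0"
    using nz(1) by auto
  \<comment> \<open>This turns the common factor \<open>th ^ N\<close> into the powers of
    \<open>nu\<close> and \<open>theta\<close> of the statement. The denominators of
    \<open>theta\<close> and \<open>nu\<close> differ in sign, which the square absorbs.\<close>
  then have th: "th = nu p1 p2 p3 p4 / theta p1 p2 p3 p4"
    using nz(2,3) unfolding th_def theta_tilde_def nu_def theta_def
    by (subst power2_commute) (simp add: power2_eq_square)
  have form: "tilde_form p1 p2 p3 p4 g h x y z = const th * (X + const g * Y + const h * Z)" for g h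
    by (simp add: tilde_form_def th_def X_def Y_def Z_def const_mult mult.assoc)
  have "?L = const (th ^ N) * ((X + Y + Z) ^ \<rho> *
      (X + const (1 - bft p1 p2 p3 p4) * Y + const (1 - bfv p1 p2 p3 p4) * Z) ^ \<sigma> *
      (X + const (1 - bfu p1 p2 p3 p4) * Y + const (1 - bfw p1 p2 p3 p4) * Z) ^ \<tau>)"
    unfolding form const_power N[symmetric] by (simp add: power_mult_distrib power_add mult_ac)
  also have "\<dots> = ?R"
    unfolding hyperP_expansion[OF N] polyP_hyperP[symmetric] sum_distrib_left
  proof (rule sum.cong[OF refl], simp only: split_paired_all prod.case)
    fix r s t :: nat
    define h where "h = polyP N p1 p2 p3 p4 (of_nat s) (of_nat t) (of_nat \<sigma>) (of_nat \<tau>)"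
    define e where "e = eta0_tilde p1 p2 p3 p4 ^ r * eta1_tilde p1 p2 p3 p4 ^ s * eta2_tilde p1 p2 p3 p4 ^ t"
    have "X ^ r * Y ^ s * Z ^ t = const e * (x ^ r * y ^ s * z ^ t)"
      by (simp add: X_def Y_def Z_def e_def power_mult_distrib const_mult const_power mult_ac)
    then have "const (th ^ N) * (const (fact N / (fact r * fact s * fact t) * h) * (X ^ r * Y ^ s * Z ^ t)) =
        const (th ^ N * (fact N / (fact r * fact s * fact t) * h) * e) * (x ^ r * y ^ s * z ^ t)"
      by (simp only: const_mult mult.assoc)
    also have "th ^ N * (fact N / (fact r * fact s * fact t) * h) * e =
        fact N * nu p1 p2 p3 p4 ^ N * (h * (e / (fact r * fact s * fact t)) / theta p1 p2 p3 p4 ^ N)"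
      by (simp add: th power_divide mult_ac)
    finally show "const (th ^ N) * (const (fact N / (fact r * fact s * fact t) * h) * (X ^ r * Y ^ s * Z ^ t)) =
        const (fact N * nu p1 p2 p3 p4 ^ N) *
        (const (h * (e / (fact r * fact s * fact t)) / theta p1 p2 p3 p4 ^ N) * (x ^ r * y ^ s * z ^ t))"
      by (simp only: const_mult mult.assoc)
  qed
  finally show ?thesis .
qed

section \<open>The tilde variables as linear forms, and the inversion of the substitution\<close>

lemma xyz_tilde_form:
  "x_tilde p1 p2 p3 p4 = tilde_form p1 p2 p3 p4 1 1 (var Ix) (var Iy) (var Iz)"
  "y_tilde p1 p2 p3 p4 = tilde_form p1 p2 p3 p4 (1 - bft p1 p2 p3 p4) (1 - bfv p1 p2 p3 p4)
    (var Ix) (var Iy) (var Iz)"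
  "z_tilde p1 p2 p3 p4 = tilde_form p1 p2 p3 p4 (1 - bfu p1 p2 p3 p4) (1 - bfw p1 p2 p3 p4)
    (var Ix) (var Iy) (var Iz)"
  by (simp_all add: x_tilde_def y_tilde_def z_tilde_def tilde_form_def)

text \<open>Collecting by indeterminate reduces the inversion to scalar identities: the coefficients
  for the three choices of \<open>g\<close> and \<open>h\<close> are the entries of a product of two
  3 by 3 matrices.\<close>

lemma tilde_form_compose:
  "tilde_form p1 p3 p2 p4 g h
      (x_tilde p1 p2 p3 p4) (y_tilde p1 p2 p3 p4) (z_tilde p1 p2 p3 p4) =
   const (theta p1 p2 p3 p4 * theta_tilde p1 p2 p3 p4 * eta0_tilde p1 p2 p3 p4 *
     (eta0 p1 p2 p3 p4 + g * eta1 p1 p2 p3 p4 + h * eta2 p1 p2 p3 p4)) * var Ix +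
   const (theta p1 p2 p3 p4 * theta_tilde p1 p2 p3 p4 * eta1_tilde p1 p2 p3 p4 *
     (eta0 p1 p2 p3 p4 + g * (1 - bft p1 p2 p3 p4) * eta1 p1 p2 p3 p4 +
      h * (1 - bfu p1 p2 p3 p4) * eta2 p1 p2 p3 p4)) * var Iy +
   const (theta p1 p2 p3 p4 * theta_tilde p1 p2 p3 p4 * eta2_tilde p1 p2 p3 p4 *
     (eta0 p1 p2 p3 p4 + g * (1 - bfv p1 p2 p3 p4) * eta1 p1 p2 p3 p4 +
      h * (1 - bfw p1 p2 p3 p4) * eta2 p1 p2 p3 p4)) * var Iz"
  unfolding tilde_form_def[of p1 p3] exchange_p2_p3[of p1 p3 p2 p4] x_tilde_def y_tilde_def z_tilde_def
  by (simp only: const_mult const_add) (simp only: algebra_simps)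

text \<open>The vectors \<open>(1, 1, 1)\<close>, \<open>(1, 1 - bft, 1 - bfu)\<close> and
  \<open>(1, 1 - bfv, 1 - bfw)\<close> are orthogonal for the weights \<open>eta0\<close>,
  \<open>eta1\<close>, \<open>eta2\<close>, and their squared norms are the reciprocals of
  \<open>nu\<close> times the tilde weights. As \<open>theta * theta_tilde\<close> equals
  \<open>nu\<close>, the composite has the identity matrix.\<close>

lemma tilde_form_inverse:
  assumes nz: "p1 \<noteq> 0" "p2 \<noteq> 0" "p3 \<noteq> 0" "p4 \<noteq> 0"
    "p1 + p2 \<noteq> 0" "p1 + p3 \<noteq> 0" "p2 + p4 \<noteq> 0" "p3 + p4 \<noteq> 0"
    "p1 + p2 + p3 + p4 \<noteq> 0" "p1 * p4 - p2 * p3 \<noteq> 0"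
  shows "tilde_form p1 p3 p2 p4 1 1
      (x_tilde p1 p2 p3 p4) (y_tilde p1 p2 p3 p4) (z_tilde p1 p2 p3 p4) = var Ix" (is ?X)
    and "tilde_form p1 p3 p2 p4 (1 - bft p1 p2 p3 p4) (1 - bfu p1 p2 p3 p4)
      (x_tilde p1 p2 p3 p4) (y_tilde p1 p2 p3 p4) (z_tilde p1 p2 p3 p4) = var Iy" (is ?Y)
    and "tilde_form p1 p3 p2 p4 (1 - bfv p1 p2 p3 p4) (1 - bfw p1 p2 p3 p4)
      (x_tilde p1 p2 p3 p4) (y_tilde p1 p2 p3 p4) (z_tilde p1 p2 p3 p4) = var Iz" (is ?Z)
proof -
  define S where "S = p1 + p2 + p3 + p4"
  define \<Delta> where "\<Delta> = p1 * p4 - p2 * p3"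
  define a b c d where "a = p1 + p2" and "b = p1 + p3" and "c = p2 + p4" and "d = p3 + p4"
  note abcd = a_def b_def c_def d_def
  have nz': "S \<noteq> 0" "\<Delta> \<noteq> 0" "a \<noteq> 0" "b \<noteq> 0" "c \<noteq> 0" "d \<noteq> 0"
    using nz by (auto simp: S_def \<Delta>_def abcd)
  have D: "p2 * p3 - p1 * p4 = - \<Delta>"
    by (simp add: \<Delta>_def)
  note nzs = nz(1-4) nz'
  \<comment> \<open>This comes from \<open>p1 * S - a * b = \<Delta>\<close>; the next three facts
    have analogous sources, with sign -1 for \<open>bfu\<close> and \<open>bfv\<close>.\<close>
  have t: "1 - bft p1 p2 p3 p4 = \<Delta> / (p1 * S)"
    using nzs unfolding bft_def S_def[symmetric]
    by (simp add: field_simps) (simp add: S_def \<Delta>_def algebra_simps)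
  have u: "1 - bfu p1 p2 p3 p4 = - \<Delta> / (p3 * S)"
    using nzs unfolding bfu_def S_def[symmetric]
    by (simp add: field_simps) (simp add: S_def \<Delta>_def algebra_simps)
  have v: "1 - bfv p1 p2 p3 p4 = - \<Delta> / (p2 * S)"
    using nzs unfolding bfv_def S_def[symmetric]
    by (simp add: field_simps) (simp add: S_def \<Delta>_def algebra_simps)
  have w: "1 - bfw p1 p2 p3 p4 = \<Delta> / (p4 * S)"
    using nzs unfolding bfw_def S_def[symmetric]
    by (simp add: field_simps) (simp add: S_def \<Delta>_def algebra_simps)
  have e0: "eta0 p1 p2 p3 p4 = \<Delta>\<^sup>2 / (a * b * c * d)"
    unfolding eta0_def nu_def abcd \<Delta>_def by simp
  have e0t: "eta0_tilde p1 p2 p3 p4 = \<Delta>\<^sup>2 / (a * b * c * d)"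
    unfolding eta0_tilde_def nu_def abcd \<Delta>_def by simp
  have e1: "eta1 p1 p2 p3 p4 = p1 * p2 * S / (a * b * c)"
    unfolding eta1_def abcd S_def by simp
  have e2: "eta2 p1 p2 p3 p4 = p3 * p4 * S / (b * c * d)"
    unfolding eta2_def abcd S_def by simp
  have e1t: "eta1_tilde p1 p2 p3 p4 = p1 * p3 * S / (a * b * d)"
    unfolding eta1_tilde_def abcd S_def by simp
  have e2t: "eta2_tilde p1 p2 p3 p4 = p2 * p4 * S / (a * c * d)"
    unfolding eta2_tilde_def abcd S_def by simp
  have th: "theta p1 p2 p3 p4 * theta_tilde p1 p2 p3 p4 = a * b * c * d / \<Delta>\<^sup>2"
    unfolding theta_def theta_tilde_def D abcd by (simp add: power2_eq_square)
  note R = t u v w e0 e0t e1 e2 e1t e2t th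
  \<comment> \<open>The norm of the first vector. Here and below, clearing denominators while
    \<open>a\<close>, \<open>b\<close>, \<open>c\<close>, \<open>d\<close>, \<open>S\<close>,
    \<open>\<Delta>\<close> stay opaque leaves one polynomial identity in the
    \<open>p\<close>'s.\<close>
  have "\<Delta>\<^sup>2 + p1 * p2 * S * d + p3 * p4 * S * a = a * b * c * d"
    unfolding abcd S_def \<Delta>_def by algebra
  moreover have "a * b * c * d / \<Delta>\<^sup>2 * (\<Delta>\<^sup>2 / (a * b * c * d)) * (\<Delta>\<^sup>2 / (a * b * c * d) + (p1 * p2 * S / (a * b * c)) + (p3 * p4 * S / (b * c * d))) =
      (\<Delta>\<^sup>2 + p1 * p2 * S * d + p3 * p4 * S * a) / (a * b * c * d)"
    using nzs by (simp add: field_simps power2_eq_square)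
  ultimately have xx: "a * b * c * d / \<Delta>\<^sup>2 * (\<Delta>\<^sup>2 / (a * b * c * d)) * (\<Delta>\<^sup>2 / (a * b * c * d) + (p1 * p2 * S / (a * b * c)) + (p3 * p4 * S / (b * c * d))) = 1"
    using nzs by simp
  \<comment> \<open>Orthogonality of the first vector to the second, and then to the third.\<close>
  have "\<Delta> + p2 * d - p4 * a = 0"
    unfolding abcd S_def \<Delta>_def by algebra
  moreover have "\<Delta>\<^sup>2 / (a * b * c * d) + (\<Delta> / (p1 * S)) * (p1 * p2 * S / (a * b * c)) + (- \<Delta> / (p3 * S)) * (p3 * p4 * S / (b * c * d)) =
      \<Delta> * (\<Delta> + p2 * d - p4 * a) / (a * b * c * d)"
    using nzs by (simp add: field_simps power2_eq_square)
  ultimately have t1: "\<Delta>\<^sup>2 / (a * b * c * d) + (\<Delta> / (p1 * S)) * (p1 * p2 * S / (a * b * c)) + (- \<Delta> / (p3 * S)) * (p3 * p4 * S / (b * c * d)) = 0"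
    using nzs by simp
  have "\<Delta> - p1 * d + p3 * a = 0"
    unfolding abcd S_def \<Delta>_def by algebra
  moreover have "\<Delta>\<^sup>2 / (a * b * c * d) + (- \<Delta> / (p2 * S)) * (p1 * p2 * S / (a * b * c)) + (\<Delta> / (p4 * S)) * (p3 * p4 * S / (b * c * d)) =
      \<Delta> * (\<Delta> - p1 * d + p3 * a) / (a * b * c * d)"
    using nzs by (simp add: field_simps power2_eq_square)
  ultimately have v1: "\<Delta>\<^sup>2 / (a * b * c * d) + (- \<Delta> / (p2 * S)) * (p1 * p2 * S / (a * b * c)) + (\<Delta> / (p4 * S)) * (p3 * p4 * S / (b * c * d)) = 0"
    using nzs by simp
  \<comment> \<open>The norms of the second and then the third vector.\<close>
  have "p1 * p3 * S + p2 * p3 * d + p1 * p4 * a = a * b * d"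
    unfolding abcd S_def \<Delta>_def by algebra
  moreover have "a * b * c * d / \<Delta>\<^sup>2 * (p1 * p3 * S / (a * b * d)) * (\<Delta>\<^sup>2 / (a * b * c * d) + (\<Delta> / (p1 * S)) * (\<Delta> / (p1 * S)) * (p1 * p2 * S / (a * b * c)) + (- \<Delta> / (p3 * S)) * (- \<Delta> / (p3 * S)) * (p3 * p4 * S / (b * c * d))) =
      (p1 * p3 * S + p2 * p3 * d + p1 * p4 * a) / (a * b * d)"
    using nzs by (simp add: field_simps power2_eq_square)
  ultimately have tt: "a * b * c * d / \<Delta>\<^sup>2 * (p1 * p3 * S / (a * b * d)) * (\<Delta>\<^sup>2 / (a * b * c * d) + (\<Delta> / (p1 * S)) * (\<Delta> / (p1 * S)) * (p1 * p2 * S / (a * b * c)) + (- \<Delta> / (p3 * S)) * (- \<Delta> / (p3 * S)) * (p3 * p4 * S / (b * c * d))) = 1"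
    using nzs by simp
  have "p2 * p4 * S + p1 * p4 * d + p2 * p3 * a = a * c * d"
    unfolding abcd S_def \<Delta>_def by algebra
  moreover have "a * b * c * d / \<Delta>\<^sup>2 * (p2 * p4 * S / (a * c * d)) * (\<Delta>\<^sup>2 / (a * b * c * d) + (- \<Delta> / (p2 * S)) * (- \<Delta> / (p2 * S)) * (p1 * p2 * S / (a * b * c)) + (\<Delta> / (p4 * S)) * (\<Delta> / (p4 * S)) * (p3 * p4 * S / (b * c * d))) =
      (p2 * p4 * S + p1 * p4 * d + p2 * p3 * a) / (a * c * d)"
    using nzs by (simp add: field_simps power2_eq_square)
  ultimately have vv: "a * b * c * d / \<Delta>\<^sup>2 * (p2 * p4 * S / (a * c * d)) * (\<Delta>\<^sup>2 / (a * b * c * d) + (- \<Delta> / (p2 * S)) * (- \<Delta> / (p2 * S)) * (p1 * p2 * S / (a * b * c)) + (\<Delta> / (p4 * S)) * (\<Delta> / (p4 * S)) * (p3 * p4 * S / (b * c * d))) = 1"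
    using nzs by simp
  \<comment> \<open>Orthogonality of the second and third vectors, which amounts to
    \<open>S = a + d\<close>.\<close>
  have "S - d - a = 0"
    unfolding abcd S_def \<Delta>_def by algebra
  moreover have "\<Delta>\<^sup>2 / (a * b * c * d) + (\<Delta> / (p1 * S)) * (- \<Delta> / (p2 * S)) * (p1 * p2 * S / (a * b * c)) + (- \<Delta> / (p3 * S)) * (\<Delta> / (p4 * S)) * (p3 * p4 * S / (b * c * d)) =
      \<Delta>\<^sup>2 * (S - d - a) / (S * a * b * c * d)"
    using nzs by (simp add: field_simps power2_eq_square)
  ultimately have tv: "\<Delta>\<^sup>2 / (a * b * c * d) + (\<Delta> / (p1 * S)) * (- \<Delta> / (p2 * S)) * (p1 * p2 * S / (a * b * c)) + (- \<Delta> / (p3 * S)) * (\<Delta> / (p4 * S)) * (p3 * p4 * S / (b * c * d)) = 0"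
    using nzs by simp
  \<comment> \<open>The same relation with its factors in the order that the coefficient of
    \<open>Iy\<close> in the third form produces.\<close>
  then have vt: "\<Delta>\<^sup>2 / (a * b * c * d) + (- \<Delta> / (p2 * S)) * (\<Delta> / (p1 * S)) * (p1 * p2 * S / (a * b * c)) + (\<Delta> / (p4 * S)) * (- \<Delta> / (p3 * S)) * (p3 * p4 * S / (b * c * d)) = 0"
    by (simp only: mult_ac)
  show ?X
    unfolding tilde_form_compose R mult_1_left xx t1 v1 tt vv tv vt by simp
  show ?Y
    unfolding tilde_form_compose R mult_1_left xx t1 v1 tt vv tv vt by simp
  show ?Z
    unfolding tilde_form_compose R mult_1_left xx t1 v1 tt vv tv vt by simp
qed

theorem theorem5p1:
  fixes p1 p2 p3 p4 :: complex and N \<rho> \<sigma> \<tau> :: nat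
  assumes "p1 \<noteq> 0" "p2 \<noteq> 0" "p3 \<noteq> 0" "p4 \<noteq> 0"
    and "p1 + p2 \<noteq> 0" "p1 + p3 \<noteq> 0" "p2 + p4 \<noteq> 0" "p3 + p4 \<noteq> 0"
    and "p1 + p2 + p3 + p4 \<noteq> 0" "p1 * p4 - p2 * p3 \<noteq> 0"
    and "\<rho> + \<sigma> + \<tau> = N"
  shows
    "(x_tilde p1 p2 p3 p4 ^ \<rho> * y_tilde p1 p2 p3 p4 ^ \<sigma> * z_tilde p1 p2 p3 p4 ^ \<tau> =
       const (fact N * nu p1 p2 p3 p4 ^ N) *
       (\<Sum>(r, s, t) \<in> {(r, s, t). r + s + t = N}.
          const (polyP N p1 p2 p3 p4 (of_nat s) (of_nat t) (of_nat \<sigma>) (of_nat \<tau>) *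
                 (eta0_tilde p1 p2 p3 p4 ^ r * eta1_tilde p1 p2 p3 p4 ^ s * eta2_tilde p1 p2 p3 p4 ^ t /
                  (fact r * fact s * fact t)) / theta p1 p2 p3 p4 ^ N) *
          (var Ix ^ r * var Iy ^ s * var Iz ^ t)))
     \<and>
     (var Ix ^ \<rho> * var Iy ^ \<sigma> * var Iz ^ \<tau> =
       const (fact N * nu p1 p2 p3 p4 ^ N) *
       (\<Sum>(r, s, t) \<in> {(r, s, t). r + s + t = N}.
          const (polyP N p1 p2 p3 p4 (of_nat \<sigma>) (of_nat \<tau>) (of_nat s) (of_nat t) *
                 (eta0 p1 p2 p3 p4 ^ r * eta1 p1 p2 p3 p4 ^ s * eta2 p1 p2 p3 p4 ^ t /
                  (fact r * fact s * fact t)) / theta_tilde p1 p2 p3 p4 ^ N) *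
          (x_tilde p1 p2 p3 p4 ^ r * y_tilde p1 p2 p3 p4 ^ s * z_tilde p1 p2 p3 p4 ^ t)))"
proof
  have \<Delta>: "p1 * p4 - p3 * p2 \<noteq> 0"
    using assms(10) by (simp add: mult.commute)
  \<comment> \<open>The expansion for exchanged \<open>p2\<close> and \<open>p3\<close>, rewritten
    in the original parameters. At the tilde variables its left side collapses to the monomial in
    \<open>x\<close>, \<open>y\<close>, \<open>z\<close>.\<close>
  note tilde_form_expansion[OF \<Delta> assms(5,8,11), unfolded exchange_p2_p3[of p1 p3 p2 p4]
      polyP_exchange[of N p1 p3 p2 p4]]
  from this[of "x_tilde p1 p2 p3 p4" "y_tilde p1 p2 p3 p4" "z_tilde p1 p2 p3 p4",
      unfolded tilde_form_inverse[OF assms(1-10)]]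
  show "var Ix ^ \<rho> * var Iy ^ \<sigma> * var Iz ^ \<tau> =
       const (fact N * nu p1 p2 p3 p4 ^ N) *
       (\<Sum>(r, s, t) \<in> {(r, s, t). r + s + t = N}.
          const (polyP N p1 p2 p3 p4 (of_nat \<sigma>) (of_nat \<tau>) (of_nat s) (of_nat t) *
                 (eta0 p1 p2 p3 p4 ^ r * eta1 p1 p2 p3 p4 ^ s * eta2 p1 p2 p3 p4 ^ t /
                  (fact r * fact s * fact t)) / theta_tilde p1 p2 p3 p4 ^ N) *
          (x_tilde p1 p2 p3 p4 ^ r * y_tilde p1 p2 p3 p4 ^ s * z_tilde p1 p2 p3 p4 ^ t))" .
qed (unfold xyz_tilde_form, rule tilde_form_expansion[OF assms(10,6,7,11)])

end
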